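(* Assume the P-Ideal Dichotomy (PID). Then every locally compact, $\omega_1$-compact, normal space of cardinality $<\mathfrak b$ is countably paracompact.
   Context: "Space" means Hausdorff topological space. A space is $\omega_1$-compact if each of its closed discrete subspaces is countable. $\mathfrak b$ is the bounding number: the least cardinality of a subset of $\omega^\omega$ that is unbounded with respect to $\le^*$. A family $\mathcal I\subset\mathcal P(X)$ is an ideal on a set $X$ if it is closed under finite unions, contains all singletons, and is closed under taking subsets of its elements. An ideal $\mathcal I$ is a P-ideal if for every countable subfamily $\mathcal Q$ of $\mathcal I$ there exists $I\in\mathcal I$ such that $Q\setminus I$ is finite for every $Q\in\mathcal Q$. The PID states that, for every P-ideal $\mathcal I$ of subsets of a set $X$, either (A) there is an uncountable $A\subset X$ such that every countable subset of $A$ is in $\mathcal I$, or (B) $X$ is the union of countably many sets $\{B_n:n\in\omega\}$ such that $B_n\cap I$ is finite for all $n$ and all $I\in\mathcal I$. *)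

theory Defs
  imports "HOL-Analysis.Analysis"
begin

unbundle cardinal_syntax

section \<open>The bounding number\<close>

definition le_star :: "(nat \<Rightarrow> nat) \<Rightarrow> (nat \<Rightarrow> nat) \<Rightarrow> bool" where
  "le_star f g \<longleftrightarrow> (\<forall>\<^sub>F n in sequentially. f n \<le> g n)"

definition le_star_unbounded :: "(nat \<Rightarrow> nat) set \<Rightarrow> bool" where
  "le_star_unbounded F \<longleftrightarrow> \<not> (\<exists>g. \<forall>f\<in>F. le_star f g)"

text \<open>
  Cardinals are represented, as usual in HOL, by well-orders of minimal order type. The
  bounding number is the cardinal of an unbounded family of least cardinality; it is determined
  up to order isomorphism, see \<open>bounding_number_least\<close>.
\<close>

definition bounding_number :: "(nat \<Rightarrow> nat) rel" where
  "bounding_number =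
     |SOME F. le_star_unbounded F \<and> (\<forall>G. le_star_unbounded G \<longrightarrow> |F| \<le>o |G| )|"

lemma le_star_unbounded_UNIV: "le_star_unbounded UNIV"
proof -
  have "\<not> le_star (\<lambda>n. Suc (g n)) g" for g
    by (auto simp: le_star_def eventually_sequentially)
  then show ?thesis
    by (auto simp: le_star_unbounded_def)
qed

lemma bounding_number_least:
  shows "\<exists>F. le_star_unbounded F \<and> bounding_number = |F|"
    and "le_star_unbounded G \<Longrightarrow> bounding_number \<le>o |G|"
proof -
  define F where "F = (SOME F. le_star_unbounded F \<and> (\<forall>G. le_star_unbounded G \<longrightarrow> |F| \<le>o |G| ))"
  have "\<exists>r \<in> {|F| | F. le_star_unbounded F}. \<forall>r' \<in> {|F| | F. le_star_unbounded F}. r \<le>o r'"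
    using le_star_unbounded_UNIV by (intro exists_minim_Card_order) (auto simp: card_of_Card_order)
  then have "\<exists>F. le_star_unbounded F \<and> (\<forall>G. le_star_unbounded G \<longrightarrow> |F| \<le>o |G| )"
    by blast
  then have F: "le_star_unbounded F \<and> (\<forall>G. le_star_unbounded G \<longrightarrow> |F| \<le>o |G| )"
    unfolding F_def by (rule someI_ex)
  have b: "bounding_number = |F|"
    by (simp add: bounding_number_def F_def)
  show "\<exists>F. le_star_unbounded F \<and> bounding_number = |F|"
    using F b by blast
  show "le_star_unbounded G \<Longrightarrow> bounding_number \<le>o |G|"
    using F b by simp
qed


section \<open>The P-ideal dichotomy\<close>

text \<open>Closure under finite unions includes the empty union, so \<open>{} \<in> \<I>\<close> even if \<open>X = {}\<close>.\<close>

definition set_ideal :: "'a set \<Rightarrow> 'a set set \<Rightarrow> bool" where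
  "set_ideal X \<I> \<longleftrightarrow>
     \<I> \<subseteq> Pow X \<and>
     (\<forall>\<F>. finite \<F> \<and> \<F> \<subseteq> \<I> \<longrightarrow> \<Union>\<F> \<in> \<I>) \<and>
     (\<forall>x\<in>X. {x} \<in> \<I>) \<and>
     (\<forall>I\<in>\<I>. \<forall>J. J \<subseteq> I \<longrightarrow> J \<in> \<I>)"

definition P_ideal :: "'a set \<Rightarrow> 'a set set \<Rightarrow> bool" where
  "P_ideal X \<I> \<longleftrightarrow>
     set_ideal X \<I> \<and>
     (\<forall>\<Q>. countable \<Q> \<and> \<Q> \<subseteq> \<I> \<longrightarrow> (\<exists>I\<in>\<I>. \<forall>Q\<in>\<Q>. finite (Q - I)))"

text \<open>
  HOL cannot quantify over types inside a formula, so the dichotomy ``for every set \<open>X\<close>'' is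
  parametrised by a type from which \<open>X\<close> is taken. The unrestricted axiom amounts to
  \<open>P_ideal_dichotomy TYPE('a)\<close> for all types \<open>'a\<close>.
\<close>

definition P_ideal_dichotomy :: "'a itself \<Rightarrow> bool" where
  "P_ideal_dichotomy _ \<longleftrightarrow>
     (\<forall>(X :: 'a set) \<I>. P_ideal X \<I> \<longrightarrow>
        (\<exists>A \<subseteq> X. uncountable A \<and> (\<forall>C \<subseteq> A. countable C \<longrightarrow> C \<in> \<I>)) \<or>
        (\<exists>B :: nat \<Rightarrow> 'a set. X = (\<Union>n. B n) \<and> (\<forall>n. \<forall>I\<in>\<I>. finite (B n \<inter> I))))"


section \<open>Topological notions\<close>

definition omega1_compact_space :: "'a topology \<Rightarrow> bool" where
  "omega1_compact_space X \<longleftrightarrow>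
     (\<forall>D. closedin X D \<and> subtopology X D = discrete_topology D \<longrightarrow> countable D)"

definition countably_paracompact_space :: "'a topology \<Rightarrow> bool" where
  "countably_paracompact_space X \<longleftrightarrow>
     (\<forall>\<U>. countable \<U> \<and> (\<forall>U\<in>\<U>. openin X U) \<and> \<Union>\<U> = topspace X \<longrightarrow>
        (\<exists>\<V>. (\<forall>V\<in>\<V>. openin X V) \<and> \<Union>\<V> = topspace X \<and>
             (\<forall>V\<in>\<V>. \<exists>U\<in>\<U>. V \<subseteq> U) \<and> locally_finite_in X \<V>))"

end

theory Submission
  imports Defs
begin

text \<open>
  Call a set \<^emph>\<open>compact-finite\<close> if it meets every compact set in a finite set. In a locally compact
  Hausdorff space \<open>X\<close> such sets are closed and discrete. The dichotomy is applied to the ideal of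
  all countable compact-finite sets.

  This is a P-ideal because \<open>X\<close> has fewer than \<open>\<bb>\<close> points: given countably many members \<open>Q n\<close>,
  each enumerated by natural numbers, every point \<open>x\<close> has a compact neighbourhood, which
  leaves \<open>Q n\<close> after some position \<open>f x n\<close>. A single function \<open>g\<close> that eventually dominates all
  the \<open>f x\<close> tells how much of each \<open>Q n\<close> to discard so that the union of the remaining tails is
  still compact-finite (\<open>P_ideal_compact_finite_ideal\<close>).

  An uncountable set all of whose countable subsets are compact-finite is itself compact-finite,
  hence closed and discrete, which \<open>\<omega>\<^sub>1\<close>-compactness forbids. So the other alternative gives
  a countable cover of \<open>X\<close> by sets \<open>B k\<close> none of which contains an infinite member of the ideal. Every
  continuous real function is bounded on such a set, since a sequence along which it tends
  to infinity would be an infinite compact-finite subset. Combined with Tietze's theorem this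
  shows that the closure of \<open>B k\<close> lies in a single member of any increasing sequence
  of open sets that covers \<open>X\<close> (\<open>closure_subset_member_of_increasing_cover\<close>). In other words, \<open>X\<close> is
  \<open>\<sigma>\<close>-countably compact. Finally, given a countable open cover, each such closure lies in a finite
  union of the cover, and normality provides room between the two; this yields a locally finite
  refinement (\<open>countable_open_cover_refinement\<close>).
\<close>

section \<open>Countable compact-finite sets\<close>

definition compact_finite :: "'a topology \<Rightarrow> 'a set \<Rightarrow> bool" where
  "compact_finite X S \<longleftrightarrow> S \<subseteq> topspace X \<and> (\<forall>K. compactin X K \<longrightarrow> finite (K \<inter> S))"

definition compact_finite_ideal :: "'a topology \<Rightarrow> 'a set set" where
  "compact_finite_ideal X = {S. countable S \<and> compact_finite X S}"

lemma compact_finiteI_locally: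
  assumes "S \<subseteq> topspace X"
    and loc: "\<And>x. x \<in> topspace X \<Longrightarrow> \<exists>U. openin X U \<and> x \<in> U \<and> finite (U \<inter> S)"
  shows "compact_finite X S"
  unfolding compact_finite_def
proof (intro conjI allI impI)
  fix K assume K: "compactin X K"
  define \<U> where "\<U> = {U. openin X U \<and> finite (U \<inter> S)}"
  have "K \<subseteq> \<Union>\<U>"
    using loc compactin_subset_topspace[OF K] unfolding \<U>_def by blast
  then obtain \<F> where \<F>: "finite \<F>" "\<F> \<subseteq> \<U>" "K \<subseteq> \<Union>\<F>"
    using K unfolding compactin_def \<U>_def by (metis (no_types, lifting) mem_Collect_eq)
  have "finite (\<Union>U\<in>\<F>. U \<inter> S)"
    using \<F> unfolding \<U>_def by blast
  then show "finite (K \<inter> S)"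
    by (rule rev_finite_subset) (use \<F> in blast)
qed (fact assms(1))

lemma compact_finite_locally_finite:
  assumes "locally_compact_space X" "compact_finite X S" "x \<in> topspace X"
  shows "\<exists>U. openin X U \<and> x \<in> U \<and> finite (U \<inter> S)"
proof -
  obtain U K where "openin X U" "compactin X K" "x \<in> U" "U \<subseteq> K"
    using assms unfolding locally_compact_space_def by blast
  moreover have "finite (K \<inter> S)"
    using assms(2) \<open>compactin X K\<close> unfolding compact_finite_def by blast
  ultimately show ?thesis
    by (meson Int_mono finite_subset order_refl)
qed

lemma derived_set_empty_if_locally_finite:
  assumes "Hausdorff_space X"
    and "\<And>x. x \<in> topspace X \<Longrightarrow> \<exists>U. openin X U \<and> x \<in> U \<and> finite (U \<inter> S)"
  shows "X derived_set_of S = {}"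
  using assms by (simp add: derived_set_of_infinite_openin) (metis Int_commute)

lemma closed_discrete_if_derived_set_empty:
  assumes "S \<subseteq> topspace X" "X derived_set_of S = {}"
  shows "closedin X S" "subtopology X S = discrete_topology S"
  using assms by (auto simp: closedin_contains_derived_set subtopology_eq_discrete_topology_eq)

lemma set_ideal_compact_finite_ideal: "set_ideal (topspace X) (compact_finite_ideal X)"
  unfolding set_ideal_def
proof (intro conjI allI impI ballI)
  show "compact_finite_ideal X \<subseteq> Pow (topspace X)"
    by (auto simp: compact_finite_ideal_def compact_finite_def)
next
  fix \<F> assume \<F>: "finite \<F> \<and> \<F> \<subseteq> compact_finite_ideal X"
  then have "countable (\<Union>S\<in>\<F>. S)"
    by (intro countable_UN) (auto simp: compact_finite_ideal_def intro: countable_finite)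
  moreover have "finite (K \<inter> \<Union>\<F>)" if "compactin X K" for K
    unfolding Int_Union using \<F> that
    by (intro finite_UN_I) (auto simp: compact_finite_ideal_def compact_finite_def)
  moreover have "\<Union>\<F> \<subseteq> topspace X"
    using \<F> by (auto simp: compact_finite_ideal_def compact_finite_def)
  ultimately show "\<Union>\<F> \<in> compact_finite_ideal X"
    by (simp add: compact_finite_ideal_def compact_finite_def)
next
  fix x assume "x \<in> topspace X"
  then show "{x} \<in> compact_finite_ideal X"
    by (auto simp: compact_finite_ideal_def compact_finite_def)
next
  fix I J assume I: "I \<in> compact_finite_ideal X" and "J \<subseteq> I"
  then have "finite (K \<inter> I) \<Longrightarrow> finite (K \<inter> J)" for K
    by (blast intro: rev_finite_subset)
  moreover have "countable J"
    using I \<open>J \<subseteq> I\<close> unfolding compact_finite_ideal_def by (blast intro: countable_subset)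
  ultimately show "J \<in> compact_finite_ideal X"
    using I \<open>J \<subseteq> I\<close> unfolding compact_finite_ideal_def compact_finite_def by blast
qed

section \<open>The ideal is a P-ideal in small spaces\<close>

lemma le_star_dominated_if_less_bounding_number:
  fixes f :: "'a \<Rightarrow> nat \<Rightarrow> nat"
  assumes "|A| <o bounding_number"
  shows "\<exists>g. \<forall>x\<in>A. le_star (f x) g"
proof (rule ccontr)
  assume "\<not> ?thesis"
  then have "le_star_unbounded (f ` A)"
    unfolding le_star_unbounded_def by blast
  then have "bounding_number \<le>o |f ` A|"
    by (rule bounding_number_least)
  then have "bounding_number \<le>o |A|"
    using card_of_image ordLeq_transitive by blast
  then show False
    using assms not_ordLess_ordLeq by blast
qed

text \<open>
  The tails of the \<open>Q n\<close> are cut off where a function dominating all points' needs says.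
  Near a point \<open>x\<close>, all but finitely many tails vanish, and the others are finite.
\<close>

lemma P_ideal_compact_finite_ideal:
  assumes lc: "locally_compact_space X" and small: "|topspace X| <o bounding_number"
  shows "P_ideal (topspace X) (compact_finite_ideal X)"
  unfolding P_ideal_def
proof (intro conjI allI impI set_ideal_compact_finite_ideal)
  fix \<Q> assume \<Q>: "countable \<Q> \<and> \<Q> \<subseteq> compact_finite_ideal X"
  show "\<exists>I\<in>compact_finite_ideal X. \<forall>Q\<in>\<Q>. finite (Q - I)"
  proof (cases "\<Q> = {}")
    case True
    have "{} \<in> compact_finite_ideal X"
      by (simp add: compact_finite_ideal_def compact_finite_def)
    with True show ?thesis by blast
  next
    case False
    define Q where "Q = from_nat_into \<Q>"
    have range_Q: "range Q = \<Q>"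
      using \<Q> False by (simp add: Q_def range_from_nat_into)
    then have Q: "countable (Q n)" "Q n \<subseteq> topspace X"
      "compactin X K \<Longrightarrow> finite (K \<inter> Q n)" for n K
      using \<Q> by (auto simp: compact_finite_ideal_def compact_finite_def)
    define e where "e n = to_nat_on (Q n)" for n
    have inj_e: "inj_on (e n) (Q n)" for n
      unfolding e_def using Q(1) by (rule inj_on_to_nat_on)
    obtain U K where UK: "\<And>x. x \<in> topspace X \<Longrightarrow>
        openin X (U x) \<and> compactin X (K x) \<and> x \<in> U x \<and> U x \<subseteq> K x"
      using lc unfolding locally_compact_space_def by metis
    define f where "f x n = (SOME m. \<forall>q \<in> K x \<inter> Q n. e n q < m)" for x n
    have f: "e n q < f x n" if "x \<in> topspace X" "q \<in> K x \<inter> Q n" for x n q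
    proof -
      have "finite (e n ` (K x \<inter> Q n))"
        using UK Q that by blast
      then have "\<exists>m. \<forall>q \<in> K x \<inter> Q n. e n q < m"
        by (auto simp: finite_nat_set_iff_bounded)
      then have "\<forall>q \<in> K x \<inter> Q n. e n q < f x n"
        unfolding f_def by (rule someI_ex)
      with that show ?thesis by blast
    qed
    obtain g where g: "\<And>x. x \<in> topspace X \<Longrightarrow> le_star (f x) g"
      using le_star_dominated_if_less_bounding_number[OF small] by blast
    define I where "I = (\<Union>n. {q \<in> Q n. g n \<le> e n q})"
    have "compact_finite X I"
    proof (rule compact_finiteI_locally)
      show "I \<subseteq> topspace X" using Q by (auto simp: I_def)
    next
      fix x assume x: "x \<in> topspace X"
      obtain N where N: "\<And>n. n \<ge> N \<Longrightarrow> f x n \<le> g n"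
        using g[OF x] by (auto simp: le_star_def eventually_sequentially)
      have "K x \<inter> I \<subseteq> (\<Union>n<N. K x \<inter> Q n)"
      proof
        fix q assume q: "q \<in> K x \<inter> I"
        then obtain n where n: "q \<in> Q n" "g n \<le> e n q" by (auto simp: I_def)
        with q f[OF x] have "g n < f x n" by fastforce
        with N have "n < N" by (meson leD leI)
        with q n show "q \<in> (\<Union>n<N. K x \<inter> Q n)" by blast
      qed
      moreover have "finite (\<Union>n<N. K x \<inter> Q n)"
        using UK[OF x] Q by blast
      ultimately have "finite (U x \<inter> I)"
        using UK[OF x] by (meson Int_mono finite_subset order_refl)
      with UK[OF x] show "\<exists>U. openin X U \<and> x \<in> U \<and> finite (U \<inter> I)" by blast
    qed
    moreover have "countable I"
      unfolding I_def using Q by (auto intro: countable_subset[of _ "Q _"])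
    moreover have "finite (Q n - I)" for n
    proof -
      have "e n ` (Q n - I) \<subseteq> {..<g n}"
        by (auto simp: I_def not_le)
      then have "finite (e n ` (Q n - I))"
        by (rule finite_subset) simp
      then show ?thesis
        by (rule finite_imageD) (use inj_e in \<open>blast intro: inj_on_subset\<close>)
    qed
    ultimately show ?thesis
      using range_Q by (auto simp: compact_finite_ideal_def)
  qed
qed

section \<open>The two alternatives of the dichotomy\<close>

lemma countable_if_countable_subsets_compact_finite:
  assumes "Hausdorff_space X" "locally_compact_space X" "omega1_compact_space X"
    and "A \<subseteq> topspace X"
    and countable_subsets: "\<And>C. C \<subseteq> A \<Longrightarrow> countable C \<Longrightarrow> C \<in> compact_finite_ideal X"
  shows "countable A"
proof -
  have "finite (K \<inter> A)" if "compactin X K" for K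
  proof (rule ccontr)
    assume "infinite (K \<inter> A)"
    then obtain C where C: "C \<subseteq> K \<inter> A" "countable C" "infinite C"
      using infinite_countable_subset' by blast
    then have "finite (K \<inter> C)"
      using countable_subsets that by (auto simp: compact_finite_ideal_def compact_finite_def)
    with C show False
      by (metis Int_absorb1 le_inf_iff)
  qed
  then have "compact_finite X A"
    using assms(4) by (simp add: compact_finite_def)
  then have "X derived_set_of A = {}"
    using derived_set_empty_if_locally_finite compact_finite_locally_finite assms(1,2) by metis
  then show ?thesis
    using closed_discrete_if_derived_set_empty assms(3,4) unfolding omega1_compact_space_def by blast
qed

text \<open>
  A sequence in \<open>B\<close> along which \<open>f\<close> tends to infinity would form an infinite
  compact-finite set, because \<open>f\<close> is bounded on compact sets.
\<close>

lemma continuous_bounded_if_no_infinite_compact_finite: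
  fixes f :: "'a \<Rightarrow> real"
  assumes B: "B \<subseteq> topspace X" "\<And>I. I \<in> compact_finite_ideal X \<Longrightarrow> finite (B \<inter> I)"
    and f: "continuous_map X euclideanreal f"
  shows "\<exists>c. \<forall>x\<in>B. f x \<le> c"
proof (rule ccontr)
  assume "\<not> ?thesis"
  then have "\<forall>n. \<exists>x\<in>B. real n < f x"
    by (meson not_le)
  then obtain b where b: "\<And>n. b n \<in> B" "\<And>n. real n < f (b n)"
    by metis
  have "compact_finite X (range b)"
    unfolding compact_finite_def
  proof (intro conjI allI impI)
    show "range b \<subseteq> topspace X" using b B by blast
    fix K assume "compactin X K"
    then have "compactin euclideanreal (f ` K)"
      using f by (rule image_compactin)
    then have "bounded (f ` K)"
      by (simp add: compact_imp_bounded)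
    then obtain c where c: "\<And>x. x \<in> K \<Longrightarrow> \<bar>f x\<bar> \<le> c"
      by (auto simp: bounded_iff)
    have "K \<inter> range b \<subseteq> b ` {..nat \<lceil>c\<rceil>}"
    proof clarify
      fix n assume "b n \<in> K"
      with b(2)[of n] c[of "b n"] have "real n \<le> c" by linarith
      then show "b n \<in> b ` {..nat \<lceil>c\<rceil>}"
        by (intro imageI) (simp, linarith)
    qed
    then show "finite (K \<inter> range b)"
      by (rule finite_subset) simp
  qed
  then have "range b \<in> compact_finite_ideal X"
    by (simp add: compact_finite_ideal_def)
  then have "finite (B \<inter> range b)" by (rule B(2))
  moreover have "B \<inter> range b = range b" using b by blast
  ultimately have fin: "finite (f ` range b)" by simp
  obtain n where "Max (f ` range b) < real n" using reals_Archimedean2 by blast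
  moreover have "f (b n) \<le> Max (f ` range b)"
    using fin by (intro Max_ge) auto
  ultimately show False using b(2)[of n] by linarith
qed

text \<open>
  Otherwise the closure contains, for each \<open>n\<close>, a point \<open>d n\<close> outside \<open>W n\<close>. These points form a
  closed discrete set, so by Tietze's theorem some continuous real function is unbounded on them.
  Being bounded on \<open>B\<close>, however, it is bounded on the closure.
\<close>

lemma closure_subset_member_of_increasing_cover:
  fixes W :: "nat \<Rightarrow> 'a set"
  assumes X: "Hausdorff_space X" "normal_space X"
    and B: "B \<subseteq> topspace X" "\<And>I. I \<in> compact_finite_ideal X \<Longrightarrow> finite (B \<inter> I)"
    and W: "\<And>n. openin X (W n)" "mono W" "(\<Union>n. W n) = topspace X"
  shows "\<exists>n. X closure_of B \<subseteq> W n"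
proof (rule ccontr)
  assume "\<not> ?thesis"
  then have "\<forall>n. \<exists>x. x \<in> X closure_of B \<and> x \<notin> W n" by blast
  then obtain d where d: "\<And>n. d n \<in> X closure_of B" "\<And>n. d n \<notin> W n" by metis
  define D where "D = range d"
  have D_sub: "D \<subseteq> topspace X"
    using d closure_of_subset_topspace unfolding D_def by fast
  have "X derived_set_of D = {}"
  proof (rule derived_set_empty_if_locally_finite[OF X(1)])
    fix x assume "x \<in> topspace X"
    then obtain n where n: "x \<in> W n" using W(3) by blast
    have "W n \<inter> D \<subseteq> d ` {..<n}"
    proof (clarsimp simp: D_def)
      fix m assume "d m \<in> W n"
      then have "m < n" using d(2)[of m] monoD[OF W(2), of n m] by (cases "n \<le> m") auto
      then show "d m \<in> d ` {..<n}" by blast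
    qed
    then have "finite (W n \<inter> D)" by (rule finite_subset) simp
    with n W(1) show "\<exists>U. openin X U \<and> x \<in> U \<and> finite (U \<inter> D)" by blast
  qed
  note D = closed_discrete_if_derived_set_empty[OF D_sub this]
  \<comment> \<open>The index of the first member of the cover containing a point is unbounded on \<open>D\<close>.\<close>
  define h where "h x = real (LEAST n. x \<in> W n)" for x
  have "continuous_map (subtopology X D) euclideanreal h"
    by (simp add: D(2))
  then obtain f where f: "continuous_map X euclideanreal f" "\<And>x. x \<in> D \<Longrightarrow> f x = h x"
    using Tietze_extension_realinterval[OF X(2) D(1), of UNIV h] by auto
  obtain c where c: "\<And>x. x \<in> B \<Longrightarrow> f x \<le> c"
    using continuous_bounded_if_no_infinite_compact_finite[OF B f(1)] by blast
  have "closedin X {x \<in> topspace X. f x \<in> {..c}}"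
    by (rule closedin_continuous_map_preimage[OF f(1)]) simp
  then have "X closure_of B \<subseteq> {x \<in> topspace X. f x \<in> {..c}}"
    by (rule closure_of_minimal[rotated]) (use B c in auto)
  then have "f (d n) \<le> c" for n
    using d(1)[of n] by blast
  then have "h (d n) \<le> c" for n
    using f(2) unfolding D_def by (metis rangeI)
  moreover have "real n < h (d n)" for n
  proof -
    have "d n \<in> (\<Union>n. W n)" using D_sub W(3) by (auto simp: D_def)
    then have *: "d n \<in> W (LEAST m. d n \<in> W m)"
      by (auto intro: LeastI)
    show ?thesis
      using d(2)[of n] monoD[OF W(2), of "LEAST m. d n \<in> W m" n] * unfolding h_def
      by (metis leI of_nat_less_iff subsetD)
  qed
  moreover obtain n where "c < real n" using reals_Archimedean2 by blast
  ultimately show False by (meson less_le_trans less_asym)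
qed

section \<open>Locally finite refinements\<close>

text \<open>
  Removing from \<open>U i\<close> the closures of those \<open>G k\<close> that earlier members of the cover together contain
  keeps \<open>V i\<close> away from \<open>G k\<close> for all large \<open>i\<close>. A point is still covered by \<open>V i\<close> for the first
  \<open>i\<close> with \<open>x \<in> U i\<close>. The extra condition \<open>k < i\<close> makes each removed set a finite union of closed sets.
\<close>

lemma countable_open_cover_refinement:
  fixes U G :: "nat \<Rightarrow> 'a set"
  assumes U: "\<And>i. openin X (U i)" "(\<Union>i. U i) = topspace X"
    and G: "\<And>k. openin X (G k)" "topspace X \<subseteq> (\<Union>k. G k)"
    and G_U: "\<And>k. X closure_of G k \<subseteq> (\<Union>i\<le>n k. U i)"
  shows "\<exists>\<V>. (\<forall>V\<in>\<V>. openin X V) \<and> \<Union>\<V> = topspace X \<and>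
             (\<forall>V\<in>\<V>. \<exists>i. V \<subseteq> U i) \<and> locally_finite_in X \<V>"
proof -
  define V where "V i = U i - (\<Union>k\<in>{k. k < i \<and> n k < i}. X closure_of G k)" for i
  have "openin X (V i)" for i
    unfolding V_def by (intro openin_diff U closedin_Union) auto
  moreover have union_V: "(\<Union>i. V i) = topspace X"
  proof
    show "(\<Union>i. V i) \<subseteq> topspace X" using U(2) by (auto simp: V_def)
    show "topspace X \<subseteq> (\<Union>i. V i)"
    proof
      fix x assume "x \<in> topspace X"
      then have "\<exists>i. x \<in> U i" using U(2) by blast
      then obtain i where i: "x \<in> U i" "\<And>j. j < i \<Longrightarrow> x \<notin> U j"
        by (auto simp: exists_least_iff[of "\<lambda>i. x \<in> U i"])
      have "x \<notin> X closure_of G k" if "n k < i" for k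
        using G_U[of k] i(2) that by fastforce
      with i(1) have "x \<in> V i" by (auto simp: V_def)
      then show "x \<in> (\<Union>i. V i)" by blast
    qed
  qed
  moreover have "locally_finite_in X (range V)"
    unfolding locally_finite_in_def
  proof (intro conjI ballI)
    show "\<Union>(range V) \<subseteq> topspace X" using union_V by simp
    fix x assume "x \<in> topspace X"
    then obtain k where k: "x \<in> G k" using G(2) by blast
    have "{S \<in> range V. S \<inter> G k \<noteq> {}} \<subseteq> V ` {..max k (n k)}"
    proof clarify
      fix i assume ne: "V i \<inter> G k \<noteq> {}"
      have "G k \<subseteq> X closure_of G k"
        by (simp add: G(1) closure_of_subset openin_subset)
      then have "\<not> (k < i \<and> n k < i)"
        using ne unfolding V_def by blast
      then show "V i \<in> V ` {..max k (n k)}" by (intro imageI) auto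
    qed
    then have "finite {S \<in> range V. S \<inter> G k \<noteq> {}}"
      by (rule finite_subset) simp
    with k G(1) show "\<exists>N. openin X N \<and> x \<in> N \<and> finite {S \<in> range V. S \<inter> N \<noteq> {}}" by blast
  qed
  moreover have "V i \<subseteq> U i" for i by (auto simp: V_def)
  ultimately show ?thesis
    by (intro exI[of _ "range V"]) blast
qed

theorem theorem2p8:
  fixes X :: "'a topology"
  assumes "P_ideal_dichotomy TYPE('a)"
    and "Hausdorff_space X"
    and "locally_compact_space X"
    and "omega1_compact_space X"
    and "normal_space X"
    and "|topspace X| <o bounding_number"
  shows "countably_paracompact_space X"
proof -
  have "P_ideal (topspace X) (compact_finite_ideal X)"
    using assms(3,6) by (rule P_ideal_compact_finite_ideal)
  moreover have "\<not> (\<exists>A \<subseteq> topspace X. uncountable A \<and>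
      (\<forall>C \<subseteq> A. countable C \<longrightarrow> C \<in> compact_finite_ideal X))"
    using countable_if_countable_subsets_compact_finite[OF assms(2-4)] by blast
  ultimately obtain B :: "nat \<Rightarrow> 'a set" where B: "topspace X = (\<Union>k. B k)"
      "\<And>k I. I \<in> compact_finite_ideal X \<Longrightarrow> finite (B k \<inter> I)"
    using assms(1) unfolding P_ideal_dichotomy_def by metis
  show ?thesis
    unfolding countably_paracompact_space_def
  proof (intro allI impI)
    fix \<U> assume \<U>: "countable \<U> \<and> (\<forall>U\<in>\<U>. openin X U) \<and> \<Union>\<U> = topspace X"
    show "\<exists>\<V>. (\<forall>V\<in>\<V>. openin X V) \<and> \<Union>\<V> = topspace X \<and>
             (\<forall>V\<in>\<V>. \<exists>U\<in>\<U>. V \<subseteq> U) \<and> locally_finite_in X \<V>"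
    proof (cases "\<U> = {}")
      case True
      with \<U> show ?thesis
        by (intro exI[of _ "{}"]) (auto simp: locally_finite_in_def)
    next
      case False
      define U where "U = from_nat_into \<U>"
      have range_U: "range U = \<U>"
        using \<U> False by (simp add: U_def range_from_nat_into)
      then have U: "openin X (U i)" "(\<Union>i. U i) = topspace X" for i
        using \<U> by auto
      define W where "W m = (\<Union>i\<le>m. U i)" for m
      have W: "openin X (W m)" "mono W" "(\<Union>m. W m) = topspace X" for m
      proof -
        show "openin X (W m)" using U(1) by (auto simp: W_def)
        show "mono W" unfolding W_def by (intro monoI UN_mono) auto
        show "(\<Union>m. W m) = topspace X" using U(2) by (auto simp: W_def)
      qed
      have B_sub: "B k \<subseteq> topspace X" for k using B(1) by blast
      have "\<exists>m. X closure_of B k \<subseteq> W m" for k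
        using closure_subset_member_of_increasing_cover[OF assms(2,5) B_sub B(2) W] by blast
      then obtain n where n: "\<And>k. X closure_of B k \<subseteq> W (n k)" by metis
      have "\<exists>G. openin X G \<and> X closure_of B k \<subseteq> G \<and> X closure_of G \<subseteq> W (n k)" for k
        using assms(5) n W(1) unfolding normal_space_alt by (meson closedin_closure_of)
      then obtain G where G: "\<And>k. openin X (G k)" "\<And>k. X closure_of B k \<subseteq> G k"
          "\<And>k. X closure_of G k \<subseteq> W (n k)"
        by metis
      have "B k \<subseteq> G k" for k
        using closure_of_subset[OF B_sub] G(2) by (rule order_trans)
      then have "topspace X \<subseteq> (\<Union>k. G k)"
        unfolding B(1) by (rule UN_mono[OF order_refl])
      from countable_open_cover_refinement[OF U G(1) this G(3)[unfolded W_def]]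
      show ?thesis using range_U by (metis rangeI)
    qed
  qed
qed

end
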